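(* Let $H=\langle x_1,\ldots,x_n\mid r_1,\ldots,r_m\rangle$ be any finitely presented group, let $F_n$ be the free group on $x_1,\ldots,x_n$ (so that $r_1,\ldots,r_m\in F_n$), and let $L_H$ be the subgroup of $F_n\times F_n$ generated by the elements $(x_i,x_i)$, $i=1,\ldots,n$, together with $(1,r_j)$, $j=1,\ldots,m$. Identify $F_n$ with the second factor $\{1\}\times F_n$. Then $L_H\cap F_n$ is the normal closure of $\{r_1,\ldots,r_m\}$ in $F_n$, and the following are equivalent: (i) $L_H$ is closed in the profinite topology of $F_n\times F_n$; (ii) $L_H\cap F_n$ is closed in the profinite topology of $F_n$; (iii) the group $H$ is residually finite.
   Context: The profinite topology on a group $G$ is the topology with the cosets of finite index normal subgroups as a base of open sets; a subgroup $K$ is closed if and only if $K=\bigcap_N KN$, where $N$ ranges over all finite index normal subgroups of $G$. A group is residually finite if its trivial subgroup is closed in its profinite topology. *)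

theory Defs
  imports "HOL-Analysis.Abstract_Topology" "HOL-Algebra.Generated_Groups"
begin

text \<open>
  A letter \<open>(x, True)\<close> stands for the generator \<open>x\<close>, and \<open>(x, False)\<close> for its formal inverse.
  The elements of the free group on \<open>X\<close> are the reduced words over \<open>X\<close>; the product
  of two of them is the reduced form of their concatenation.
\<close>

type_synonym 'a word = "('a \<times> bool) list"

fun inv_letter :: "'a \<times> bool \<Rightarrow> 'a \<times> bool" where
  "inv_letter (x, b) = (x, \<not> b)"

definition reduced :: "'a word \<Rightarrow> bool" where
  "reduced w \<longleftrightarrow> successively (\<lambda>a b. b \<noteq> inv_letter a) w"

fun push :: "'a \<times> bool \<Rightarrow> 'a word \<Rightarrow> 'a word" where
  "push a [] = [a]"
| "push a (b # w) = (if b = inv_letter a then w else a # b # w)"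

definition free_group :: "'a set \<Rightarrow> 'a word monoid" where
  "free_group X =
     \<lparr>carrier = {w. reduced w \<and> fst ` set w \<subseteq> X},
      monoid.mult = (\<lambda>u v. foldr push u v),
      one = []\<rparr>"

definition free_gen :: "'a \<Rightarrow> 'a word" where
  "free_gen x = [(x, True)]"

lemma inv_letter_inv_letter [simp]: "inv_letter (inv_letter a) = a"
  by (cases a) simp

lemma fst_inv_letter [simp]: "fst (inv_letter a) = fst a"
  by (cases a) simp

lemma inv_letter_neq [simp]: "inv_letter a \<noteq> a" "a \<noteq> inv_letter a"
  by (cases a; simp)+

lemma reduced_simps [simp]:
  "reduced []" "reduced [a]"
  "reduced (a # b # w) \<longleftrightarrow> b \<noteq> inv_letter a \<and> reduced (b # w)"
  by (simp_all add: reduced_def)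

lemma reduced_ConsD: "reduced (a # w) \<Longrightarrow> reduced w"
  by (cases w) auto

lemma reduced_push: "reduced w \<Longrightarrow> reduced (push a w)"
  by (cases w) (auto dest: reduced_ConsD)

lemma fst_set_push: "fst ` set (push a w) \<subseteq> insert (fst a) (fst ` set w)"
  by (cases w) auto

lemma push_push_inv:
  assumes "reduced w"
  shows "push a (push (inv_letter a) w) = w"
proof (cases w)
  case (Cons b v)
  then show ?thesis using assms by (cases v) auto
qed simp

lemma reduced_foldr_push: "reduced w \<Longrightarrow> reduced (foldr push u w)"
  by (induction u) (auto intro: reduced_push)

lemma fst_set_foldr_push: "fst ` set (foldr push u w) \<subseteq> fst ` set u \<union> fst ` set w"
proof (induction u)
  case (Cons a u)
  have "fst ` set (foldr push (a # u) w) \<subseteq> insert (fst a) (fst ` set (foldr push u w))"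
    using fst_set_push[of a "foldr push u w"] by (simp only: foldr.simps o_apply)
  also have "\<dots> \<subseteq> insert (fst a) (fst ` set u \<union> fst ` set w)"
    using Cons.IH by (rule insert_mono)
  finally show ?case by simp
qed simp

lemma foldr_push_Nil: "reduced w \<Longrightarrow> foldr push w [] = w"
proof (induction w)
  case (Cons a w)
  then have "foldr push w [] = w" by (blast dest: reduced_ConsD)
  then show ?case using Cons.prems by (cases w) auto
qed simp

lemma foldr_push_push:
  assumes "reduced w"
  shows "foldr push (push a u) w = push a (foldr push u w)"
proof (cases u)
  case (Cons b v)
  then show ?thesis
    using push_push_inv[OF reduced_foldr_push[OF assms], of a v] by auto
qed simp

lemma foldr_push_assoc:
  assumes "reduced w"
  shows "foldr push (foldr push u v) w = foldr push u (foldr push v w)"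
  by (induction u) (simp_all add: foldr_push_push[OF assms])

lemma foldr_push_inverse:
  assumes "reduced v"
  shows "foldr push (rev (map inv_letter w)) (foldr push w v) = v"
  using assms
proof (induction w)
  case (Cons a w)
  then show ?case
    using push_push_inv[OF reduced_foldr_push[OF Cons.prems], of "inv_letter a" w] by simp
qed simp

theorem group_free_group: "group (free_group X)"
proof (rule groupI)
  fix u v w
  assume u: "u \<in> carrier (free_group X)" and v: "v \<in> carrier (free_group X)"
  show "u \<otimes>\<^bsub>free_group X\<^esub> v \<in> carrier (free_group X)"
  proof -
    have "fst ` set (foldr push u v) \<subseteq> X"
      using u v by (intro order_trans[OF fst_set_foldr_push]) (simp add: free_group_def)
    then show ?thesis
      using v by (simp add: free_group_def reduced_foldr_push)
  qed
  assume w: "w \<in> carrier (free_group X)"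
  then show "u \<otimes>\<^bsub>free_group X\<^esub> v \<otimes>\<^bsub>free_group X\<^esub> w
      = u \<otimes>\<^bsub>free_group X\<^esub> (v \<otimes>\<^bsub>free_group X\<^esub> w)"
    by (simp add: free_group_def foldr_push_assoc)
next
  fix w assume w: "w \<in> carrier (free_group X)"
  let ?w' = "foldr push (rev (map inv_letter w)) []"
  have "foldr push ?w' w = foldr push (rev (map inv_letter w)) (foldr push w [])"
    using w by (simp add: free_group_def foldr_push_assoc foldr_push_Nil)
  also have "\<dots> = []"
    by (rule foldr_push_inverse) simp
  finally have 1: "foldr push ?w' w = []" .
  have "fst ` set ?w' \<subseteq> fst ` set w"
    using fst_set_foldr_push[of "rev (map inv_letter w)" "[]"] by (simp add: image_image)
  then have "?w' \<in> carrier (free_group X)"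
    using w by (auto simp: free_group_def intro!: reduced_foldr_push)
  then show "\<exists>w'\<in>carrier (free_group X). w' \<otimes>\<^bsub>free_group X\<^esub> w = \<one>\<^bsub>free_group X\<^esub>"
    using 1 by (auto simp: free_group_def)
qed (auto simp: free_group_def)

definition normal_closure :: "('a, 'b) monoid_scheme \<Rightarrow> 'a set \<Rightarrow> 'a set" where
  "normal_closure G R = \<Inter>{N. N \<lhd> G \<and> R \<subseteq> N}"

text \<open>The generators \<open>x\<^sub>1, \<dots>, x\<^sub>n\<close> are indexed by \<open>{1..n}\<close>; both \<open>n = 0\<close> and \<open>m = 0\<close> are allowed.\<close>

abbreviation free_group_rank :: "nat \<Rightarrow> nat word monoid" where
  "free_group_rank n \<equiv> free_group {1..n}"

definition presented_group :: "nat \<Rightarrow> nat \<Rightarrow> (nat \<Rightarrow> nat word) \<Rightarrow> nat word set monoid" where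
  "presented_group n m r =
     free_group_rank n Mod normal_closure (free_group_rank n) (r ` {1..m})"

definition L_subgroup :: "nat \<Rightarrow> nat \<Rightarrow> (nat \<Rightarrow> nat word) \<Rightarrow> (nat word \<times> nat word) set" where
  "L_subgroup n m r =
     generate (free_group_rank n \<times>\<times> free_group_rank n)
       ((\<lambda>i. (free_gen i, free_gen i)) ` {1..n} \<union>
        (\<lambda>j. (\<one>\<^bsub>free_group_rank n\<^esub>, r j)) ` {1..m})"

text \<open>The intersection of a subset of \<open>G \<times> K\<close> with the second factor, viewed as a subset of \<open>K\<close>.\<close>

definition inter_snd_factor ::
    "('a, 'c) monoid_scheme \<Rightarrow> ('b, 'd) monoid_scheme \<Rightarrow> ('a \<times> 'b) set \<Rightarrow> 'b set" where
  "inter_snd_factor G K L = {w \<in> carrier K. (\<one>\<^bsub>G\<^esub>, w) \<in> L}"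

definition finite_index_normal :: "('a, 'b) monoid_scheme \<Rightarrow> 'a set \<Rightarrow> bool" where
  "finite_index_normal G N \<longleftrightarrow> N \<lhd> G \<and> finite (rcosets\<^bsub>G\<^esub> N)"

definition profinite_topology :: "('a, 'b) monoid_scheme \<Rightarrow> 'a topology" where
  "profinite_topology G =
     topology (arbitrary union_of
       (\<lambda>U. \<exists>N a. finite_index_normal G N \<and> a \<in> carrier G \<and> U = N #>\<^bsub>G\<^esub> a))"

definition residually_finite :: "('a, 'b) monoid_scheme \<Rightarrow> bool" where
  "residually_finite G \<longleftrightarrow> closedin (profinite_topology G) {\<one>\<^bsub>G\<^esub>}"

text \<open>
  The function \<^const>\<open>topology\<close> is only meaningful on families satisfying \<^const>\<open>istopology\<close>.
  This holds here because an intersection of two cosets is empty or a coset of the intersection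
  of the two subgroups.
\<close>

lemma (in group) finite_index_normal_Int:
  assumes "finite_index_normal G M" "finite_index_normal G N"
  shows "finite_index_normal G (M \<inter> N)"
proof -
  have M: "M \<lhd> G" "finite (rcosets M)" and N: "N \<lhd> G" "finite (rcosets N)"
    using assms by (auto simp: finite_index_normal_def)
  have sub: "subgroup M G" "subgroup N G"
    using M N by (auto intro: normal_imp_subgroup)
  have "(M \<inter> N) #> a = (M #> a) \<inter> (N #> a)" if a: "a \<in> carrier G" for a
  proof
    show "(M #> a) \<inter> (N #> a) \<subseteq> (M \<inter> N) #> a"
    proof
      fix x assume "x \<in> (M #> a) \<inter> (N #> a)"
      then obtain u v where "u \<in> M" "v \<in> N" "x = u \<otimes> a" "x = v \<otimes> a"
        by (auto simp: r_coset_def)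
      moreover from this have "u = v"
        using a sub by (metis right_cancel subgroup.mem_carrier)
      ultimately show "x \<in> (M \<inter> N) #> a"
        by (auto simp: r_coset_def)
    qed
  qed (auto simp: r_coset_def)
  then have "rcosets (M \<inter> N) \<subseteq> (\<lambda>(A, B). A \<inter> B) ` ((rcosets M) \<times> (rcosets N))"
    by (force simp: RCOSETS_def)
  then have "finite (rcosets (M \<inter> N))"
    using M N by (meson finite_SigmaI finite_imageI finite_subset)
  then show ?thesis
    using M N normal_subgroup_intersect by (auto simp: finite_index_normal_def)
qed

lemma (in group) openin_profinite_topology:
  "openin (profinite_topology G) U \<longleftrightarrow>
     U \<subseteq> carrier G \<and> (\<forall>x\<in>U. \<exists>N. finite_index_normal G N \<and> N #> x \<subseteq> U)"
proof -
  let ?B = "\<lambda>U. \<exists>N a. finite_index_normal G N \<and> a \<in> carrier G \<and> U = N #> a"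
  have sub: "subgroup N G" if "finite_index_normal G N" for N
    using that by (auto simp: finite_index_normal_def intro: normal_imp_subgroup)
  have car: "N #> a \<subseteq> carrier G" if "finite_index_normal G N" "a \<in> carrier G" for N a
    using that by (meson r_coset_subset_G sub subgroup.subset)
  have self: "x \<in> N #> x" if "finite_index_normal G N" "x \<in> carrier G" for N x
    using that rcos_self sub by blast
  have eq: "N #> a = N #> x" if "finite_index_normal G N" "a \<in> carrier G" "x \<in> N #> a" for N a x
    using that repr_independence sub by blast
  have *: "(arbitrary union_of ?B) U \<longleftrightarrow>
     U \<subseteq> carrier G \<and> (\<forall>x\<in>U. \<exists>N. finite_index_normal G N \<and> N #> x \<subseteq> U)" for U
    unfolding arbitrary_union_of_alt
    by (intro iffI conjI ballI subsetI) (metis car eq self subsetD)+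
  have "istopology (arbitrary union_of ?B)"
    unfolding istopology_base_alt *
  proof (intro allI impI conjI ballI)
    fix S T x
    assume ST: "(S \<subseteq> carrier G \<and> (\<forall>x\<in>S. \<exists>N. finite_index_normal G N \<and> N #> x \<subseteq> S)) \<and>
      T \<subseteq> carrier G \<and> (\<forall>x\<in>T. \<exists>N. finite_index_normal G N \<and> N #> x \<subseteq> T)"
    then show "S \<inter> T \<subseteq> carrier G" by blast
    assume "x \<in> S \<inter> T"
    then obtain M N where "finite_index_normal G M" "M #> x \<subseteq> S"
      "finite_index_normal G N" "N #> x \<subseteq> T"
      using ST by (meson IntD1 IntD2)
    then show "\<exists>N. finite_index_normal G N \<and> N #> x \<subseteq> S \<inter> T"
      by (intro exI[of _ "M \<inter> N"]) (auto simp: finite_index_normal_Int r_coset_def)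
  qed
  then have "openin (profinite_topology G) = arbitrary union_of ?B"
    unfolding profinite_topology_def by (rule topology_inverse')
  then show ?thesis
    using *[of U] by (simp only:)
qed

lemma (in group) finite_index_normal_carrier: "finite_index_normal G (carrier G)"
proof -
  have "rcosets (carrier G) \<subseteq> {carrier G}"
    by (auto simp: RCOSETS_def coset_join2 subgroup_self)
  then have "finite (rcosets (carrier G))"
    by (rule finite_subset) simp
  moreover have "carrier G \<lhd> G"
    by (simp add: normal_inv_iff subgroup_self)
  ultimately show ?thesis
    by (simp add: finite_index_normal_def)
qed

lemma (in group) topspace_profinite_topology: "topspace (profinite_topology G) = carrier G"
proof -
  have "openin (profinite_topology G) (carrier G)"
    unfolding openin_profinite_topology
    by (metis order_refl r_coset_subset_G finite_index_normal_carrier)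
  then show ?thesis
    using openin_profinite_topology
    by (metis openin_subset openin_topspace subset_antisym)
qed

theorem (in group) closedin_profinite_topology_iff:
  assumes K: "subgroup K G"
  shows "closedin (profinite_topology G) K \<longleftrightarrow> K = (\<Inter>N\<in>{N. finite_index_normal G N}. K <#> N)"
proof -
  have Kc: "K \<subseteq> carrier G"
    using K by (rule subgroup.subset)
  have disj: "N #> x \<subseteq> carrier G - K \<longleftrightarrow> x \<notin> K <#> N"
    if N: "finite_index_normal G N" and x: "x \<in> carrier G" for N x
  proof -
    have nN: "N \<lhd> G" using N by (simp add: finite_index_normal_def)
    then have sN: "subgroup N G" by (rule normal_imp_subgroup)
    have coset: "N #> x = x <# N" using nN x by (simp add: normal.coset_eq)
    have "x \<in> K <#> N" if "h \<in> N" "x \<otimes> h \<in> K" for h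
    proof -
      have "x = (x \<otimes> h) \<otimes> inv h"
        using that x sN by (simp add: m_assoc subgroup.mem_carrier)
      then show ?thesis
        using that sN unfolding set_mult_def by (blast intro: subgroup.m_inv_closed)
    qed
    moreover have "\<exists>h\<in>N. x \<otimes> h \<in> K" if "x \<in> K <#> N"
    proof -
      obtain k h where kh: "k \<in> K" "h \<in> N" "x = k \<otimes> h"
        using \<open>x \<in> K <#> N\<close> unfolding set_mult_def by blast
      then have "x \<otimes> inv h = k"
        using Kc sN by (auto simp: m_assoc subgroup.mem_carrier)
      then show ?thesis
        using kh sN by (metis subgroup.m_inv_closed)
    qed
    moreover have "x <# N \<subseteq> carrier G"
      using x sN by (simp add: l_coset_subset_G subgroup.subset)
    ultimately show ?thesis
      unfolding coset by (auto simp: l_coset_def)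
  qed
  have G: "finite_index_normal G (carrier G)"
    by (rule finite_index_normal_carrier)
  have "K \<subseteq> K <#> N" if N: "finite_index_normal G N" for N
  proof
    fix k assume k: "k \<in> K"
    have "\<one> \<in> N"
      using N by (simp add: finite_index_normal_def normal_imp_subgroup subgroup.one_closed)
    then show "k \<in> K <#> N"
      using k Kc unfolding set_mult_def by force
  qed
  moreover have "K <#> carrier G \<subseteq> carrier G"
    using Kc by (simp add: set_mult_closed)
  moreover have "closedin (profinite_topology G) K \<longleftrightarrow>
      (\<forall>x\<in>carrier G - K. \<exists>N. finite_index_normal G N \<and> x \<notin> K <#> N)"
    unfolding closedin_def topspace_profinite_topology openin_profinite_topology
    using Kc disj by (meson Diff_iff Diff_subset)
  ultimately show ?thesis
    using G by blast
qed

end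

theory Submission
  imports Defs "HOL-Analysis.Abstract_Topological_Spaces"
begin

(* Let N be the normal closure of the relators in F and let p : F -> H be the presentation map,
   whose kernel is N. The slice {w. (1, w) \<in> L} is invariant under conjugation because L
   contains the diagonal, so it contains N, and L turns out to be the fibre product
   {(a, b). p a = p b}. Homomorphisms are continuous for the profinite topologies and surjective
   ones are open. Hence N = p^-1(1) is closed if and only if the trivial subgroup of H is, and N is
   closed if L is, being its preimage under w \<mapsto> (1, w). Conversely, if H is residually finite then
   its profinite topology is Hausdorff, so L is closed as the equalizer of the two continuous
   maps p \<circ> fst and p \<circ> snd. *)

section \<open>Homomorphisms and profinite topologies\<close>

lemma (in group_hom) subgroup_preimage:
  assumes "subgroup M H"
  shows "subgroup {x \<in> carrier G. h x \<in> M} G"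
proof -
  interpret M: subgroup M H by fact
  show ?thesis by (rule G.subgroupI) (auto intro: exI[of _ \<one>])
qed

lemma (in group_hom) normal_preimage:
  assumes "M \<lhd> H"
  shows "{x \<in> carrier G. h x \<in> M} \<lhd> G"
  using assms subgroup_preimage[of M] unfolding G.normal_inv_iff H.normal_inv_iff by auto

text \<open>Membership of \<open>y\<close> in the coset of \<open>x\<close> means that
  \<open>y \<otimes> inv x\<close> lies in the subgroup, and \<open>h\<close> carries this quotient
  to the quotient of \<open>h y\<close> and \<open>h x\<close>.\<close>

lemma (in group_hom) rcoset_preimage:
  assumes "subgroup M H" and "x \<in> carrier G"
  shows "{y \<in> carrier G. h y \<in> M} #> x = {y \<in> carrier G. h y \<in> M #>\<^bsub>H\<^esub> h x}"
proof -
  have "y \<in> {y \<in> carrier G. h y \<in> M} #> x \<longleftrightarrow> h y \<in> M #>\<^bsub>H\<^esub> h x" if "y \<in> carrier G" for y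
    using assms that by (simp add: subgroup.rcos_module[OF subgroup_preimage G.group_axioms]
        subgroup.rcos_module[OF _ H.group_axioms])
  moreover have "{y \<in> carrier G. h y \<in> M} #> x \<subseteq> carrier G"
    using assms by (intro G.r_coset_subset_G) auto
  ultimately show ?thesis by blast
qed

text \<open>Each coset of the preimage is the preimage of a coset of \<open>M\<close>, so it has at
  most as many cosets as \<open>M\<close>.\<close>

lemma (in group_hom) finite_index_normal_preimage:
  assumes "finite_index_normal H M"
  shows "finite_index_normal G {x \<in> carrier G. h x \<in> M}"
proof -
  have M: "M \<lhd> H" "finite (rcosets\<^bsub>H\<^esub> M)"
    using assms by (auto simp: finite_index_normal_def)
  have "{x \<in> carrier G. h x \<in> M} #> a
      \<in> (\<lambda>C. {y \<in> carrier G. h y \<in> C}) ` (rcosets\<^bsub>H\<^esub> M)" if "a \<in> carrier G" for a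
    using that M by (simp add: rcoset_preimage normal_imp_subgroup H.rcosetsI
        normal_imp_subgroup[THEN subgroup.subset])
  then have "rcosets {x \<in> carrier G. h x \<in> M}
      \<subseteq> (\<lambda>C. {y \<in> carrier G. h y \<in> C}) ` (rcosets\<^bsub>H\<^esub> M)"
    by (auto simp: RCOSETS_def)
  then show ?thesis
    using M normal_preimage unfolding finite_index_normal_def by (blast intro: finite_surj)
qed

section \<open>Images of cosets and of finite index normal subgroups\<close>

lemma (in group_hom) rcoset_image:
  assumes "M \<subseteq> carrier G" and "x \<in> carrier G"
  shows "h ` (M #> x) = h ` M #>\<^bsub>H\<^esub> h x"
proof -
  have "h (m \<otimes> x) = h m \<otimes>\<^bsub>H\<^esub> h x" if "m \<in> M" for m
    using assms that by auto
  then show ?thesis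
    by (auto simp: r_coset_def image_iff)
qed

text \<open>By surjectivity every coset of the image has a representative \<open>h a\<close>, hence
  is the image of the coset of \<open>a\<close>; surjectivity also makes the image normal.\<close>

lemma (in group_hom) finite_index_normal_image:
  assumes surj: "h ` carrier G = carrier H" and "finite_index_normal G M"
  shows "finite_index_normal H (h ` M)"
proof -
  have M: "M \<lhd> G" "finite (rcosets M)"
    using assms by (auto simp: finite_index_normal_def)
  have "M \<subseteq> carrier G"
    using M by (simp add: normal_imp_subgroup subgroup.subset)
  then have "h ` M #>\<^bsub>H\<^esub> h a \<in> (\<lambda>C. h ` C) ` (rcosets M)" if "a \<in> carrier G" for a
    using that by (simp add: rcoset_image[symmetric] G.rcosetsI)
  then have "rcosets\<^bsub>H\<^esub> (h ` M) \<subseteq> (\<lambda>C. h ` C) ` (rcosets M)"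
    unfolding RCOSETS_def surj[symmetric] by auto
  then have "finite (rcosets\<^bsub>H\<^esub> (h ` M))"
    using M by (blast intro: finite_surj)
  then show ?thesis
    using normal.surj_hom_normal_subgroup[OF M(1) group_hom_axioms surj]
    by (simp add: finite_index_normal_def)
qed

section \<open>Continuity and openness of homomorphisms\<close>

lemma (in group_hom) continuous_map_profinite_topology:
  "continuous_map (profinite_topology G) (profinite_topology H) h"
  unfolding continuous_map G.topspace_profinite_topology H.topspace_profinite_topology
proof (intro conjI allI impI)
  fix U assume U: "openin (profinite_topology H) U"
  show "openin (profinite_topology G) {x \<in> carrier G. h x \<in> U}"
    unfolding G.openin_profinite_topology
  proof (intro conjI ballI)
    fix x assume x: "x \<in> {x \<in> carrier G. h x \<in> U}"
    then obtain M where M: "finite_index_normal H M" "M #>\<^bsub>H\<^esub> h x \<subseteq> U"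
      using U unfolding H.openin_profinite_topology by blast
    then have "{y \<in> carrier G. h y \<in> M} #> x = {y \<in> carrier G. h y \<in> M #>\<^bsub>H\<^esub> h x}"
      using x by (intro rcoset_preimage) (auto simp: finite_index_normal_def normal_imp_subgroup)
    with M show "\<exists>N. finite_index_normal G N \<and> N #> x \<subseteq> {x \<in> carrier G. h x \<in> U}"
      by (intro exI[of _ "{y \<in> carrier G. h y \<in> M}"]) (auto simp: finite_index_normal_preimage)
  qed auto
qed auto

lemma (in group_hom) open_map_profinite_topology:
  assumes surj: "h ` carrier G = carrier H"
  shows "open_map (profinite_topology G) (profinite_topology H) h"
  unfolding open_map_def
proof (intro allI impI)
  fix U assume "openin (profinite_topology G) U"
  then have U: "U \<subseteq> carrier G" "\<And>x. x \<in> U \<Longrightarrow> \<exists>N. finite_index_normal G N \<and> N #> x \<subseteq> U"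
    by (auto simp: G.openin_profinite_topology)
  show "openin (profinite_topology H) (h ` U)"
    unfolding H.openin_profinite_topology
  proof (intro conjI ballI)
    fix y assume "y \<in> h ` U"
    then obtain x N where x: "x \<in> U" "y = h x" and N: "finite_index_normal G N" "N #> x \<subseteq> U"
      using U by blast
    have "N \<subseteq> carrier G"
      using N by (simp add: finite_index_normal_def normal_imp_subgroup subgroup.subset)
    then have "h ` N #>\<^bsub>H\<^esub> y = h ` (N #> x)"
      using x U by (subst rcoset_image) auto
    then show "\<exists>M. finite_index_normal H M \<and> M #>\<^bsub>H\<^esub> y \<subseteq> h ` U"
      using N finite_index_normal_image[OF surj] by (metis image_mono)
  qed (use U in auto)
qed

text \<open>Continuity gives one direction, the kernel being the preimage of the identity. For the
  other, the kernel is a full fibre, so the open map \<open>h\<close> sends its complement exactly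
  onto the complement of the identity.\<close>

lemma (in group_hom) closedin_kernel_iff_residually_finite:
  assumes surj: "h ` carrier G = carrier H"
  shows "closedin (profinite_topology G) (kernel G H h) \<longleftrightarrow> residually_finite H"
proof
  assume "residually_finite H"
  then show "closedin (profinite_topology G) (kernel G H h)"
    using closedin_continuous_map_preimage[OF continuous_map_profinite_topology]
    by (fastforce simp: residually_finite_def kernel_def G.topspace_profinite_topology)
next
  assume "closedin (profinite_topology G) (kernel G H h)"
  then have "openin (profinite_topology G) (carrier G - kernel G H h)"
    by (simp add: closedin_def G.topspace_profinite_topology)
  then have "openin (profinite_topology H) (h ` (carrier G - kernel G H h))"
    using open_map_profinite_topology[OF surj] by (simp add: open_map_def)
  moreover have "h ` (carrier G - kernel G H h) = carrier H - {\<one>\<^bsub>H\<^esub>}"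
    unfolding surj[symmetric] by (auto simp: kernel_def)
  ultimately show "residually_finite H"
    by (simp add: residually_finite_def closedin_def H.topspace_profinite_topology)
qed

section \<open>Separation of points by cosets\<close>

lemma (in group) openin_profinite_topology_rcoset:
  assumes "finite_index_normal G N" and "a \<in> carrier G"
  shows "openin (profinite_topology G) (N #> a)"
  unfolding openin_profinite_topology
proof (intro conjI ballI)
  have N: "subgroup N G"
    using assms by (simp add: finite_index_normal_def normal_imp_subgroup)
  then show "N #> a \<subseteq> carrier G"
    using assms by (simp add: r_coset_subset_G subgroup.subset)
  fix x assume "x \<in> N #> a"
  then have "N #> a = N #> x"
    using N assms by (intro repr_independence)
  then show "\<exists>M. finite_index_normal G M \<and> M #> x \<subseteq> N #> a"
    using assms by blast
qed

text \<open>Translation reduces separating \<open>x\<close> from \<open>y\<close> to separating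
  \<open>x \<otimes> inv y\<close> from the identity: a suitable \<open>N\<close> puts
  \<open>x\<close> and \<open>y\<close> in different cosets, which are open and disjoint.\<close>

lemma (in group) Hausdorff_space_profinite_topology:
  assumes "residually_finite G"
  shows "Hausdorff_space (profinite_topology G)"
  unfolding Hausdorff_space_def topspace_profinite_topology
proof (intro allI impI)
  fix x y assume xy: "x \<in> carrier G \<and> y \<in> carrier G \<and> x \<noteq> y"
  have "openin (profinite_topology G) (carrier G - {\<one>})"
    using assms by (simp add: residually_finite_def closedin_def topspace_profinite_topology)
  moreover have "x \<otimes> inv y \<in> carrier G - {\<one>}"
    using xy by (metis DiffI inv_closed inv_equality inv_inv m_closed singletonD)
  ultimately obtain N where N: "finite_index_normal G N" "N #> (x \<otimes> inv y) \<subseteq> carrier G - {\<one>}"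
    unfolding openin_profinite_topology by blast
  then have sub: "subgroup N G"
    by (simp add: finite_index_normal_def normal_imp_subgroup)
  \<comment> \<open>Otherwise the coset of \<open>x \<otimes> inv y\<close> would be
    \<open>N\<close> itself, which contains the identity.\<close>
  have "x \<otimes> inv y \<notin> N"
    using N sub xy by (metis coset_join2 DiffD2 inv_closed m_closed singletonI subgroup.one_closed subsetD)
  then have "x \<notin> N #> y"
    using sub xy by (simp add: subgroup.rcos_module[OF _ group_axioms])
  then have "N #> x \<noteq> N #> y"
    using sub xy rcos_self[of x N] by auto
  then have "disjnt (N #> x) (N #> y)"
    using sub xy by (metis disjnt_iff repr_independence)
  then show "\<exists>U V. openin (profinite_topology G) U \<and> openin (profinite_topology G) V \<and>
      x \<in> U \<and> y \<in> V \<and> disjnt U V"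
    using N(1) sub xy
    by (intro exI[of _ "N #> x"] exI[of _ "N #> y"])
      (simp add: openin_profinite_topology_rcoset rcos_self)
qed

section \<open>Fibre products\<close>

text \<open>As \<open>R\<close> lies in the carrier, the carrier is one of the intersected
  subgroups, so the intersection is over a nonempty family.\<close>

lemma (in group) normal_normal_closure:
  assumes "R \<subseteq> carrier G"
  shows "normal_closure G R \<lhd> G"
proof -
  have "subgroup (normal_closure G R) G"
    unfolding normal_closure_def using assms normal_self normal_imp_subgroup
    by (intro subgroups_Inter) auto
  then show ?thesis
    unfolding normal_inv_iff by (auto simp: normal_closure_def normal_inv_iff)
qed

text \<open>The condition on \<open>b \<otimes> inv a\<close> says that \<open>a\<close> and
  \<open>b\<close> agree modulo the normal closure, so the right-hand side is the fibre product over
  the quotient.\<close>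

lemma (in group) generate_diagonal_eq_fibre_product:
  assumes gen: "generate G S = carrier G" and S: "S \<subseteq> carrier G" and R: "R \<subseteq> carrier G"
  shows "generate (G \<times>\<times> G) ((\<lambda>s. (s, s)) ` S \<union> Pair \<one> ` R)
    = {(a, b) \<in> carrier G \<times> carrier G. b \<otimes> inv a \<in> normal_closure G R}"
    (is "?L = ?P")
proof -
  interpret GG: group "G \<times>\<times> G" by (simp add: DirProd_group)
  interpret N: normal "normal_closure G R" G using R by (rule normal_normal_closure)
  have gens: "(\<lambda>s. (s, s)) ` S \<union> Pair \<one> ` R \<subseteq> carrier (G \<times>\<times> G)"
    using S R by auto
  then have L: "subgroup ?L (G \<times>\<times> G)"
    by (rule GG.generate_is_subgroup)
  have R_closure: "R \<subseteq> normal_closure G R"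
    by (auto simp: normal_closure_def)
  show ?thesis
  proof
    \<comment> \<open>A subgroup containing the generators contains \<open>?L\<close>. Normality
      enters in both closure properties.\<close>
    have "subgroup ?P (G \<times>\<times> G)"
    proof (rule GG.subgroupI)
      show "?P \<noteq> {}" by (auto intro!: exI[of _ \<one>])
    next
      fix u assume "u \<in> ?P"
      then obtain a b where u: "u = (a, b)" "a \<in> carrier G" "b \<in> carrier G"
        "b \<otimes> inv a \<in> normal_closure G R" by auto
      \<comment> \<open>The inverse pair requires \<open>inv b \<otimes> a\<close>, which is a
        conjugate of the inverse of \<open>b \<otimes> inv a\<close>.\<close>
      have "inv b \<otimes> inv (b \<otimes> inv a) \<otimes> b \<in> normal_closure G R"
        using u by (intro N.inv_op_closed1) auto
      also have "inv b \<otimes> inv (b \<otimes> inv a) \<otimes> b = inv b \<otimes> a"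
        using u by (simp add: inv_mult_group m_assoc)
      finally show "inv\<^bsub>G \<times>\<times> G\<^esub> u \<in> ?P"
        using u by simp
    next
      fix u v assume "u \<in> ?P" "v \<in> ?P"
      then obtain a b c d where u: "u = (a, b)" "a \<in> carrier G" "b \<in> carrier G"
        "b \<otimes> inv a \<in> normal_closure G R"
        and v: "v = (c, d)" "c \<in> carrier G" "d \<in> carrier G"
        "d \<otimes> inv c \<in> normal_closure G R" by auto
      \<comment> \<open>Conjugating the second quotient by \<open>b\<close> lets it be multiplied
        with the first to give the quotient of the product pair.\<close>
      have "(b \<otimes> (d \<otimes> inv c) \<otimes> inv b) \<otimes> (b \<otimes> inv a) \<in> normal_closure G R"
        using u v by (simp add: N.m_closed[OF N.inv_op_closed2] del: N.m_closed)
      also have "(b \<otimes> (d \<otimes> inv c) \<otimes> inv b) \<otimes> (b \<otimes> inv a) = (b \<otimes> d) \<otimes> inv (a \<otimes> c)"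
        using u v by (simp add: inv_mult_group m_assoc inv_solve_left')
      finally show "u \<otimes>\<^bsub>G \<times>\<times> G\<^esub> v \<in> ?P"
        using u v by simp
    qed auto
    then show "?L \<subseteq> ?P"
      using S R R_closure by (intro GG.generate_subgroup_incl) auto
  next
    \<comment> \<open>Induction on the generation of \<open>a\<close> from \<open>S\<close>, carried
      out in both coordinates at once.\<close>
    have diag: "(a, a) \<in> ?L" if "a \<in> carrier G" for a
    proof -
      have "a \<in> generate G S" using that gen by simp
      then show ?thesis
      proof induction
        case one
        show ?case using subgroup.one_closed[OF L] by simp
      next
        case (incl s)
        then show ?case by (blast intro: generate.incl)
      next
        case (inv s)
        then have "inv\<^bsub>G \<times>\<times> G\<^esub> (s, s) \<in> ?L" by (blast intro: generate.inv)
        then show ?case using inv S by auto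
      next
        case (eng s t)
        then show ?case using subgroup.m_closed[OF L eng.IH] by simp
      qed
    qed
    define K where "K = {w \<in> carrier G. (\<one>, w) \<in> ?L}"
    have "subgroup K G"
    proof (rule subgroupI)
      show "K \<noteq> {}" using diag[of \<one>] by (auto simp: K_def)
    next
      fix w assume "w \<in> K"
      then show "inv w \<in> K"
        using subgroup.m_inv_closed[OF L, of "(\<one>, w)"] by (auto simp: K_def)
    next
      fix v w assume "v \<in> K" "w \<in> K"
      then show "v \<otimes> w \<in> K"
        using subgroup.m_closed[OF L, of "(\<one>, v)" "(\<one>, w)"] by (auto simp: K_def)
    qed (auto simp: K_def)
    \<comment> \<open>Conjugation by \<open>(a, a)\<close> keeps the first coordinate trivial and
      conjugates the second by an arbitrary \<open>a\<close>.\<close>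
    moreover have "a \<otimes> w \<otimes> inv a \<in> K" if "a \<in> carrier G" "w \<in> K" for a w
    proof -
      have "(a, a) \<otimes>\<^bsub>G \<times>\<times> G\<^esub> (\<one>, w) \<otimes>\<^bsub>G \<times>\<times> G\<^esub> (inv a, inv a) \<in> ?L"
        using that by (intro subgroup.m_closed[OF L] diag) (auto simp: K_def)
      then show ?thesis using that by (simp add: K_def)
    qed
    moreover have "R \<subseteq> K"
      using R by (auto simp: K_def intro: generate.incl)
    ultimately have NK: "normal_closure G R \<subseteq> K"
      unfolding normal_closure_def by (intro Inter_lower) (simp add: normal_inv_iff)
    show "?P \<subseteq> ?L"
    proof clarify
      fix a b assume ab: "a \<in> carrier G" "b \<in> carrier G" "b \<otimes> inv a \<in> normal_closure G R"
      \<comment> \<open>This product is \<open>(a, b)\<close>, split into an element of the second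
        factor and a diagonal element.\<close>
      then have "(\<one>, b \<otimes> inv a) \<otimes>\<^bsub>G \<times>\<times> G\<^esub> (a, a) \<in> ?L"
        using NK by (intro subgroup.m_closed[OF L] diag) (auto simp: K_def)
      then show "(a, b) \<in> ?L" using ab by (simp add: m_assoc)
    qed
  qed
qed

section \<open>Free groups and presentations\<close>

lemma inv_free_gen:
  assumes "x \<in> X"
  shows "inv\<^bsub>free_group X\<^esub> free_gen x = [(x, False)]"
  using assms
  by (intro group.inv_equality[OF group_free_group]) (auto simp: free_group_def free_gen_def)

lemma generate_free_gen: "generate (free_group X) (free_gen ` X) = carrier (free_group X)"
proof
  interpret group "free_group X" by (rule group_free_group)
  show "generate (free_group X) (free_gen ` X) \<subseteq> carrier (free_group X)"
    by (intro generate_incl) (auto simp: free_group_def free_gen_def)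
  have letter: "[a] \<in> generate (free_group X) (free_gen ` X)" if "fst a \<in> X" for a
  proof (cases a)
    case (Pair x b)
    then have "[a] = (if b then free_gen x else inv\<^bsub>free_group X\<^esub> free_gen x)"
      using that by (simp add: inv_free_gen[unfolded free_gen_def] free_gen_def)
    then show ?thesis
      using that Pair by (auto intro: generate.incl generate.inv)
  qed
  show "carrier (free_group X) \<subseteq> generate (free_group X) (free_gen ` X)"
  proof
    fix w assume "w \<in> carrier (free_group X)"
    then show "w \<in> generate (free_group X) (free_gen ` X)"
    proof (induction w)
      case Nil
      then show ?case using generate.one[of "free_group X"] by (simp add: free_group_def)
    next
      case (Cons a w)
      then have w: "w \<in> carrier (free_group X)" and a: "fst a \<in> X"
        by (auto simp: free_group_def dest: reduced_ConsD)
      \<comment> \<open>No cancellation occurs, because \<open>a # w\<close> is reduced.\<close>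
      have "a # w = [a] \<otimes>\<^bsub>free_group X\<^esub> w"
        using Cons.prems by (cases w) (auto simp: free_group_def)
      then show ?case
        using letter[OF a] Cons.IH[OF w] by (metis generate.eng)
    qed
  qed
qed

text \<open>\<open>H\<close> is given only up to isomorphism, so \<open>p\<close> is the quotient
  projection followed by an isomorphism onto \<open>H\<close>.\<close>

lemma presentation_map_exists:
  assumes "group G" "group H" and N: "N \<lhd> G" and iso: "H \<cong> G Mod N"
  obtains p where "group_hom G H p" "p ` carrier G = carrier H" "kernel G H p = N"
proof -
  interpret G: group G by fact
  interpret H: group H by fact
  interpret N: normal N G by fact
  interpret Q: group "G Mod N" by (rule N.factorgroup_is_group)
  \<comment> \<open>The isomorphism is reversed, since a map out of the quotient is needed.\<close>
  obtain f where f: "f \<in> iso (G Mod N) H"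
    using H.iso_sym[OF iso] by (auto simp: is_iso_def)
  then have f': "f \<in> hom (G Mod N) H" "kernel (G Mod N) H f = {N}"
    "f ` carrier (G Mod N) = carrier H"
    using iso_kernel_image[OF Q.group_axioms H.group_axioms] by auto
  define p where "p = f \<circ> (\<lambda>a. N #>\<^bsub>G\<^esub> a)"
  have "p \<in> hom G H"
    unfolding p_def using N.r_coset_hom_Mod f'(1) by (rule hom_compose)
  then have "group_hom G H p"
    by (simp add: group_hom_def group_hom_axioms_def G.group_axioms H.group_axioms)
  moreover have Q: "carrier (G Mod N) = (\<lambda>a. N #>\<^bsub>G\<^esub> a) ` carrier G"
    by (auto simp: FactGroup_def RCOSETS_def)
  then have "p ` carrier G = carrier H"
    using f'(3) by (simp add: p_def image_comp)
  moreover have "p a = \<one>\<^bsub>H\<^esub> \<longleftrightarrow> a \<in> N" if a: "a \<in> carrier G" for a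
  proof -
    \<comment> \<open>The identity of the quotient is the coset \<open>N\<close>, the only element
      of the kernel of \<open>f\<close>.\<close>
    have "p a = \<one>\<^bsub>H\<^esub> \<longleftrightarrow> N #>\<^bsub>G\<^esub> a = N"
      using f'(2) Q a by (auto simp: p_def kernel_def set_eq_iff)
    also have "\<dots> \<longleftrightarrow> a \<in> N"
      using a N.subgroup_axioms by (metis G.coset_join1 G.coset_join2 N.subset)
    finally show ?thesis .
  qed
  then have "kernel G H p = N"
    using N.subset by (auto simp: kernel_def)
  ultimately show thesis by (rule that)
qed

section \<open>The three equivalent conditions\<close>

theorem mainTheorem3:
  fixes n m :: nat
    and r :: "nat \<Rightarrow> nat word"
    and H :: "('h, 'k) monoid_scheme"
  assumes relators: "\<And>j. j \<in> {1..m} \<Longrightarrow> r j \<in> carrier (free_group_rank n)"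
    and "group H"
    and presentation: "H \<cong> presented_group n m r"
  shows "inter_snd_factor (free_group_rank n) (free_group_rank n) (L_subgroup n m r)
           = normal_closure (free_group_rank n) (r ` {1..m})
       \<and> (closedin (profinite_topology (free_group_rank n \<times>\<times> free_group_rank n)) (L_subgroup n m r)
            \<longleftrightarrow> closedin (profinite_topology (free_group_rank n))
                  (inter_snd_factor (free_group_rank n) (free_group_rank n) (L_subgroup n m r)))
       \<and> (closedin (profinite_topology (free_group_rank n))
                  (inter_snd_factor (free_group_rank n) (free_group_rank n) (L_subgroup n m r))
            \<longleftrightarrow> residually_finite H)"
proof -
  note One_nat_def [simp del]
  let ?F = "free_group_rank n" and ?L = "L_subgroup n m r"
  let ?N = "normal_closure ?F (r ` {1..m})" and ?K = "inter_snd_factor ?F ?F ?L"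
  interpret F: group ?F by (rule group_free_group)
  interpret H: group H by fact
  interpret FF: group "?F \<times>\<times> ?F" by (intro DirProd_group F.group_axioms)
  have R: "r ` {1..m} \<subseteq> carrier ?F"
    using relators by blast
  interpret N: normal ?N ?F
    using R by (rule F.normal_normal_closure)
  obtain p where p: "group_hom ?F H p" "p ` carrier ?F = carrier H" "kernel ?F H p = ?N"
    using presentation_map_exists[OF F.group_axioms H.group_axioms N.normal_axioms]
      presentation unfolding presented_group_def by blast
  interpret p: group_hom ?F H p by fact
  have "free_gen ` {1..n} \<subseteq> carrier ?F"
    by (auto simp: free_group_def free_gen_def)
  then have L: "?L = {(a, b) \<in> carrier ?F \<times> carrier ?F. b \<otimes>\<^bsub>?F\<^esub> inv\<^bsub>?F\<^esub> a \<in> ?N}"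
    using F.generate_diagonal_eq_fibre_product[OF generate_free_gen _ R]
    by (simp add: L_subgroup_def image_image)
  \<comment> \<open>Setting \<open>a\<close> to the identity in the fibre product leaves the
    condition that \<open>b\<close> lies in \<open>?N\<close>.\<close>
  have K: "?K = ?N"
    using N.subset by (auto simp: inter_snd_factor_def L)
  have K_iff: "closedin (profinite_topology ?F) ?K \<longleftrightarrow> residually_finite H"
    unfolding K using p.closedin_kernel_iff_residually_finite p by simp
  have "closedin (profinite_topology ?F) ?K"
    if closed: "closedin (profinite_topology (?F \<times>\<times> ?F)) ?L"
  proof -
    \<comment> \<open>The inclusion of the second factor is continuous, and \<open>?K\<close> is the
      preimage of \<open>?L\<close> under it.\<close>
    interpret i: group_hom ?F "?F \<times>\<times> ?F" "Pair \<one>\<^bsub>?F\<^esub>"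
      by unfold_locales (auto simp: hom_def)
    show ?thesis
      using closedin_continuous_map_preimage[OF i.continuous_map_profinite_topology closed]
      by (simp only: inter_snd_factor_def F.topspace_profinite_topology)
  qed
  moreover have "closedin (profinite_topology (?F \<times>\<times> ?F)) ?L" if "residually_finite H"
  proof -
    interpret p1: group_hom "?F \<times>\<times> ?F" H "p \<circ> fst"
      by unfold_locales (auto simp: hom_def)
    interpret p2: group_hom "?F \<times>\<times> ?F" H "p \<circ> snd"
      by unfold_locales (auto simp: hom_def)
    \<comment> \<open>As \<open>?N\<close> is the kernel of \<open>p\<close>, this turns
      \<open>?L\<close> into the equalizer of \<open>p \<circ> fst\<close> and
      \<open>p \<circ> snd\<close>.\<close>
    have "b \<otimes>\<^bsub>?F\<^esub> inv\<^bsub>?F\<^esub> a \<in> ?N \<longleftrightarrow> p a = p b"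
      if "a \<in> carrier ?F" "b \<in> carrier ?F" for a b
    proof -
      have "b \<otimes>\<^bsub>?F\<^esub> inv\<^bsub>?F\<^esub> a \<in> ?N \<longleftrightarrow> p b \<otimes>\<^bsub>H\<^esub> inv\<^bsub>H\<^esub> p a = \<one>\<^bsub>H\<^esub>"
        unfolding p(3)[symmetric] using that by (simp add: kernel_def)
      also have "\<dots> \<longleftrightarrow> p a = p b"
        using that by (metis H.inv_equality H.inv_inv H.inv_closed H.r_inv p.hom_closed)
      finally show ?thesis .
    qed
    then have "?L = {x \<in> topspace (profinite_topology (?F \<times>\<times> ?F)). (p \<circ> fst) x = (p \<circ> snd) x}"
      by (auto simp: L FF.topspace_profinite_topology)
    then show ?thesis
      using closedin_continuous_maps_eq[OF H.Hausdorff_space_profinite_topology[OF that]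
          p1.continuous_map_profinite_topology p2.continuous_map_profinite_topology] by simp
  qed
  \<comment> \<open>The implications from (i) to (ii) and from (iii) to (i), with the equivalence of
    (ii) and (iii) in \<open>K_iff\<close>, close the cycle.\<close>
  ultimately show ?thesis
    using K K_iff by blast
qed

end
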